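(* Let $c\geq 1$ be an integer, let $\alpha\in\mathbb{Z}$, $\beta\in 2\mathbb{Z}$ and $U_0\in 2\mathbb{Z}+(c-1)$. For $n\in\mathbb{Z}$ define $U_n=\alpha n(n-1)+\beta n+U_0$ and $Z_n=\frac12(U_n+U_{n-1})$. If $c=\alpha U_0+\frac{\alpha\beta}{2}-\frac{\beta^2}{4}$, then $U_n^2+c=Z_nZ_{n+1}$ for all $n\in\mathbb{Z}$. *)

theory Defs
  imports Complex_Main
begin

definition U :: "int \<Rightarrow> int \<Rightarrow> int \<Rightarrow> int \<Rightarrow> int" where
  "U \<alpha> \<beta> U0 n = \<alpha> * n * (n - 1) + \<beta> * n + U0"

(* Rational-valued, so that the factor 1/2 is exact division rather than integer division. *)
definition Z :: "int \<Rightarrow> int \<Rightarrow> int \<Rightarrow> int \<Rightarrow> rat" where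
  "Z \<alpha> \<beta> U0 n = 1 / 2 * (of_int (U \<alpha> \<beta> U0 n) + of_int (U \<alpha> \<beta> U0 (n - 1)))"

end

theory Submission
  imports Defs
begin

text \<open>Both factors are shifts of U_n: with t half the increment U_{n+1} - U_n, their product
  exceeds U_n^2 by \<alpha>(U_n + t) - t^2. This excess does not depend on n, and its value is
  c.\<close>

theorem proposition3p1p1:
  fixes c \<alpha> \<beta> U0 :: int
  assumes "c \<ge> 1"
    and "even \<beta>"
    and "even (U0 - (c - 1))"
    and "(of_int c :: rat) =
           of_int \<alpha> * of_int U0 + of_int \<alpha> * of_int \<beta> / 2 - (of_int \<beta>)\<^sup>2 / 4"
  shows "\<forall>n::int. (of_int (U \<alpha> \<beta> U0 n))\<^sup>2 + of_int c = Z \<alpha> \<beta> U0 n * Z \<alpha> \<beta> U0 (n + 1)"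
proof
  fix n :: int
  let ?W = "of_int (U \<alpha> \<beta> U0 n) :: rat"
  \<comment> \<open>Half of U_{n+1} - U_n; half of U_n - U_{n-1} is then \<open>?t\<close> -
    \<alpha>.\<close>
  let ?t = "of_int \<alpha> * of_int n + of_int \<beta> / 2 :: rat"
  have Z: "Z \<alpha> \<beta> U0 n = ?W + of_int \<alpha> - ?t" "Z \<alpha> \<beta> U0 (n + 1) = ?W + ?t"
    by (simp_all add: Z_def U_def field_simps)
  \<comment> \<open>All terms in n cancel on the right, leaving its value at n = 0, the assumed
    formula for c.\<close>
  have c: "of_int c = of_int \<alpha> * (?W + ?t) - ?t\<^sup>2"
    using assms(4) by (simp add: U_def field_simps power2_eq_square)
  show "?W\<^sup>2 + of_int c = Z \<alpha> \<beta> U0 n * Z \<alpha> \<beta> U0 (n + 1)"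
    unfolding Z c by (simp add: algebra_simps power2_eq_square)
qed

end
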